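(* 1. Let $G^{\min-\mathrm{mag}}=(N,X,(\pi_i^{\mathrm{mag}})_{i\in N})$ be a monotone aggregative minimization game, let $u\in\mathbb{R}^m_+$, and let $G^{\min}(u)=(N,X,(\pi_i)_{i\in N})$ be the associated game with $\pi_i(u,x_i):=\pi_i^{\mathrm{mag}}(u,x_i)$ for $x_i\in X_i$, $i\in N$. If $(x^*,\lambda)\in X\times\mathbb{R}^m_+$ enforces $u$ for $G^{\min}(u)$, then $(x^*,\lambda)$ also enforces $u$ for $G^{\min-\mathrm{mag}}$. 2. Let $G^{\max-\mathrm{mag}}=(N,X,(v_i^{\mathrm{mag}})_{i\in N})$ be a monotone aggregative maximization game, let $u\in\mathbb{R}^m_+$, and let $G^{\max}(u)=(N,X,(v_i)_{i\in N})$ be the associated game with $v_i(u,x_i):=v_i^{\mathrm{mag}}(u,x_i)$ for $x_i\in X_i$, $i\in N$. If $(x^*,\lambda)\in X\times\mathbb{R}^m_+$ enforces $u$ for $G^{\max}(u)$, then $(x^*,\lambda)$ also enforces $u$ for $G^{\max-\mathrm{mag}}$.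
   Context: Setting. $E=\{1,\dots,m\}$ (resources) and $N=\{1,\dots,n\}$ (players) are finite nonempty sets; for $i\in N$, $\emptyset\neq X_i\subseteq\mathbb{R}^m_+$, $X=\prod_{i\in N}X_i$, $g_i:X_i\to\mathbb{R}^m_+$ with components $g_{ij}$, and $\ell(x)=\sum_{i\in N}g_i(x_i)$. Write $E(x_i)=\{j\in E:x_{ij}>0\}$. Notation: $(x_i,x_{-i}^* )$ is $x^*$ with player $i$'s strategy replaced by $x_i$. A monotone aggregative minimization (resp. maximization) game has costs $\pi_i^{\mathrm{mag}}(\ell(x),x_i)$ (resp. utilities $v_i^{\mathrm{mag}}(\ell(x),x_i)$) at $x\in X$, with functions $\pi_i^{\mathrm{mag}}:\mathbb{R}^m_+\times X_i\to\mathbb{R}$ (resp. $v_i^{\mathrm{mag}}:\mathbb{R}^m_+\times X_i\to\mathbb{R}$), such that for all $i\in N$: (i) Monotonicity (negative externalities): for all $x_i\in X_i$ and $u\le w$ in $\mathbb{R}^m_+$, $\pi_i^{\mathrm{mag}}(u,x_i)\le\pi_i^{\mathrm{mag}}(w,x_i)$ (resp. $v_i^{\mathrm{mag}}(u,x_i)\ge v_i^{\mathrm{mag}}(w,x_i)$). (ii) Independence of irrelevant alternatives: for all $x_i\in X_i$ and $u,w\in\mathbb{R}^m_+$ with $u_j=w_j$ for all $j\in E(x_i)$, $\pi_i^{\mathrm{mag}}(u,x_i)=\pi_i^{\mathrm{mag}}(w,x_i)$ (resp. $v_i^{\mathrm{mag}}(u,x_i)=v_i^{\mathrm{mag}}(w,x_i)$).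 (iii) Overlapping structure: $g_{ij}(x_i)=g_{ij}(y_i)$ for all $x_i,y_i\in X_i$ and $j\in E(x_i)\cap E(y_i)$. Enforcement. $(x^*,\lambda)$ enforces $u$ for $G^{\min}(u)$ if $\ell(x^* )=u$ and $x_i^*\in\arg\min_{x_i\in X_i}\{\pi_i(u,x_i)+\lambda^\intercal g_i(x_i)\}$ for all $i\in N$; for $G^{\max}(u)$ if $\ell(x^* )=u$ and $x_i^*\in\arg\max_{x_i\in X_i}\{v_i(u,x_i)-\lambda^\intercal g_i(x_i)\}$ for all $i\in N$. It enforces $u$ for $G^{\min-\mathrm{mag}}$ if $\ell(x^* )=u$ and $x_i^*\in\arg\min_{x_i\in X_i}\{\pi_i^{\mathrm{mag}}(\ell(x_i,x_{-i}^* ),x_i)+\lambda^\intercal g_i(x_i)\}$ for all $i\in N$; for $G^{\max-\mathrm{mag}}$ if $\ell(x^* )=u$ and $x_i^*\in\arg\max_{x_i\in X_i}\{v_i^{\mathrm{mag}}(\ell(x_i,x_{-i}^* ),x_i)-\lambda^\intercal g_i(x_i)\}$ for all $i\in N$.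
   Formalization: Both parts additionally assume g_ij(y_i) ≤ g_ij(x_i) for all i, x_i, y_i in X_i and j in E(x_i) \ E(y_i) (true e.g. if unused resources are not consumed); without this the claim is false. *)

theory Defs
  imports "HOL-Analysis.Analysis"
begin

text \<open>Players and resources are the elements of the finite types \<open>'n\<close> and \<open>'e\<close>. The order on
  \<open>real ^ 'e\<close> is componentwise, so \<open>0 \<le> u\<close> says that \<open>u\<close> lies in the nonnegative orthant. Functions
  with domain \<open>X i\<close> are total functions about which nothing is required outside \<open>X i\<close>.\<close>

definition resource_model ::
  "('n::finite \<Rightarrow> (real ^ 'e::finite) set) \<Rightarrow> ('n \<Rightarrow> real ^ 'e \<Rightarrow> real ^ 'e) \<Rightarrow> bool" where
  "resource_model X g \<longleftrightarrow>
     (\<forall>i. X i \<noteq> {} \<and> X i \<subseteq> {x. 0 \<le> x} \<and> g i \<in> X i \<rightarrow> {z. 0 \<le> z})"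

definition load :: "('n::finite \<Rightarrow> real ^ 'e::finite \<Rightarrow> real ^ 'e) \<Rightarrow> ('n \<Rightarrow> real ^ 'e) \<Rightarrow> real ^ 'e" where
  "load g x = (\<Sum>i\<in>UNIV. g i (x i))"

definition used_resources :: "real ^ 'e::finite \<Rightarrow> 'e set" where
  "used_resources x = {j. 0 < x $ j}"

definition irrelevant_independent ::
  "('n::finite \<Rightarrow> (real ^ 'e::finite) set) \<Rightarrow> ('n \<Rightarrow> real ^ 'e \<Rightarrow> real ^ 'e \<Rightarrow> real) \<Rightarrow> bool" where
  "irrelevant_independent X f \<longleftrightarrow>
     (\<forall>i. \<forall>x\<in>X i. \<forall>u w. 0 \<le> u \<and> 0 \<le> w \<and> (\<forall>j\<in>used_resources x. u $ j = w $ j)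
        \<longrightarrow> f i u x = f i w x)"

definition overlapping_structure ::
  "('n::finite \<Rightarrow> (real ^ 'e::finite) set) \<Rightarrow> ('n \<Rightarrow> real ^ 'e \<Rightarrow> real ^ 'e) \<Rightarrow> bool" where
  "overlapping_structure X g \<longleftrightarrow>
     (\<forall>i. \<forall>x\<in>X i. \<forall>y\<in>X i. \<forall>j \<in> used_resources x \<inter> used_resources y. g i x $ j = g i y $ j)"

definition monotone_aggregative_min ::
  "('n::finite \<Rightarrow> (real ^ 'e::finite) set) \<Rightarrow> ('n \<Rightarrow> real ^ 'e \<Rightarrow> real ^ 'e) \<Rightarrow>
   ('n \<Rightarrow> real ^ 'e \<Rightarrow> real ^ 'e \<Rightarrow> real) \<Rightarrow> bool" where
  "monotone_aggregative_min X g \<pi> \<longleftrightarrow>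
     (\<forall>i. \<forall>x\<in>X i. \<forall>u w. 0 \<le> u \<and> u \<le> w \<longrightarrow> \<pi> i u x \<le> \<pi> i w x) \<and>
     irrelevant_independent X \<pi> \<and> overlapping_structure X g"

definition monotone_aggregative_max ::
  "('n::finite \<Rightarrow> (real ^ 'e::finite) set) \<Rightarrow> ('n \<Rightarrow> real ^ 'e \<Rightarrow> real ^ 'e) \<Rightarrow>
   ('n \<Rightarrow> real ^ 'e \<Rightarrow> real ^ 'e \<Rightarrow> real) \<Rightarrow> bool" where
  "monotone_aggregative_max X g v \<longleftrightarrow>
     (\<forall>i. \<forall>x\<in>X i. \<forall>u w. 0 \<le> u \<and> u \<le> w \<longrightarrow> v i w x \<le> v i u x) \<and>
     irrelevant_independent X v \<and> overlapping_structure X g"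

text \<open>Using a resource never consumes less of it than leaving it unused; in particular this holds
  if an unused resource is not consumed at all, that is, if \<open>g i y $ j = 0\<close> whenever \<open>y $ j = 0\<close>.
  This is not part of the definition of a monotone aggregative game, and the overlapping structure
  does not imply it: it says nothing about \<open>g i y $ j\<close> if \<open>y $ j = 0\<close>. Enforcement does not
  transfer without it. With one player, one resource, strategies \<open>0\<close> and \<open>1\<close>, consumptions
  \<open>g 0 = 5\<close> and \<open>g 1 = 0\<close>, and costs \<open>\<pi> w 0 = 1\<close> and \<open>\<pi> w 1 = w\<close>, the strategy \<open>0\<close> with price \<open>0\<close>
  enforces the load \<open>5\<close> when loads are fixed at \<open>5\<close>, but deviating to \<open>1\<close> lowers the actual load
  to \<open>0\<close> and the cost from \<open>1\<close> to \<open>0\<close>. In the same way every model that violates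
  the condition admits costs (and utilities) for which the transfer fails.\<close>
definition use_monotone ::
  "('n::finite \<Rightarrow> (real ^ 'e::finite) set) \<Rightarrow> ('n \<Rightarrow> real ^ 'e \<Rightarrow> real ^ 'e) \<Rightarrow> bool" where
  "use_monotone X g \<longleftrightarrow>
     (\<forall>i. \<forall>x\<in>X i. \<forall>y\<in>X i. \<forall>j \<in> used_resources x - used_resources y. g i y $ j \<le> g i x $ j)"

definition enforces_min ::
  "('n::finite \<Rightarrow> (real ^ 'e::finite) set) \<Rightarrow> ('n \<Rightarrow> real ^ 'e \<Rightarrow> real ^ 'e) \<Rightarrow>
   ('n \<Rightarrow> real ^ 'e \<Rightarrow> real ^ 'e \<Rightarrow> real) \<Rightarrow> real ^ 'e \<Rightarrow> ('n \<Rightarrow> real ^ 'e) \<Rightarrow> real ^ 'e \<Rightarrow> bool" where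
  "enforces_min X g \<pi> u xs p \<longleftrightarrow> load g xs = u \<and>
     (\<forall>i. is_arg_min (\<lambda>y. \<pi> i u y + p \<bullet> g i y) (\<lambda>y. y \<in> X i) (xs i))"

definition enforces_max ::
  "('n::finite \<Rightarrow> (real ^ 'e::finite) set) \<Rightarrow> ('n \<Rightarrow> real ^ 'e \<Rightarrow> real ^ 'e) \<Rightarrow>
   ('n \<Rightarrow> real ^ 'e \<Rightarrow> real ^ 'e \<Rightarrow> real) \<Rightarrow> real ^ 'e \<Rightarrow> ('n \<Rightarrow> real ^ 'e) \<Rightarrow> real ^ 'e \<Rightarrow> bool" where
  "enforces_max X g v u xs p \<longleftrightarrow> load g xs = u \<and>
     (\<forall>i. is_arg_max (\<lambda>y. v i u y - p \<bullet> g i y) (\<lambda>y. y \<in> X i) (xs i))"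

definition enforces_min_mag ::
  "('n::finite \<Rightarrow> (real ^ 'e::finite) set) \<Rightarrow> ('n \<Rightarrow> real ^ 'e \<Rightarrow> real ^ 'e) \<Rightarrow>
   ('n \<Rightarrow> real ^ 'e \<Rightarrow> real ^ 'e \<Rightarrow> real) \<Rightarrow> real ^ 'e \<Rightarrow> ('n \<Rightarrow> real ^ 'e) \<Rightarrow> real ^ 'e \<Rightarrow> bool" where
  "enforces_min_mag X g \<pi> u xs p \<longleftrightarrow> load g xs = u \<and>
     (\<forall>i. is_arg_min (\<lambda>y. \<pi> i (load g (xs(i := y))) y + p \<bullet> g i y) (\<lambda>y. y \<in> X i) (xs i))"

definition enforces_max_mag ::
  "('n::finite \<Rightarrow> (real ^ 'e::finite) set) \<Rightarrow> ('n \<Rightarrow> real ^ 'e \<Rightarrow> real ^ 'e) \<Rightarrow>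
   ('n \<Rightarrow> real ^ 'e \<Rightarrow> real ^ 'e \<Rightarrow> real) \<Rightarrow> real ^ 'e \<Rightarrow> ('n \<Rightarrow> real ^ 'e) \<Rightarrow> real ^ 'e \<Rightarrow> bool" where
  "enforces_max_mag X g v u xs p \<longleftrightarrow> load g xs = u \<and>
     (\<forall>i. is_arg_max (\<lambda>y. v i (load g (xs(i := y))) y - p \<bullet> g i y) (\<lambda>y. y \<in> X i) (xs i))"

end

theory Submission imports Defs begin

text \<open>Let player \<open>i\<close> deviate from an enforced profile with load \<open>u\<close> to \<open>y\<close>, and let \<open>w\<close> be the
  resulting load. Then \<open>u \<le> w\<close> on the resources used by \<open>y\<close>: those that \<open>i\<close> used before keep their
  load by the overlapping structure, and the load of the others does not drop. Resources not used
  by \<open>y\<close> are irrelevant, so the actual cost of \<open>y\<close> at \<open>w\<close> is at least its cost at the fixed load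
  \<open>u\<close>. As \<open>w = u\<close> when there is no deviation, optimality at fixed load is inherited. Maximization
  is minimization of the negated utilities.\<close>

lemma load_fun_upd:
  "load g (x(i := y)) = load g x - g i (x i) + g i y"
proof -
  have "load g z = g i (z i) + (\<Sum>k\<in>UNIV - {i}. g k (z k))" for z
    unfolding load_def by (rule sum.remove) auto
  moreover have "(\<Sum>k\<in>UNIV - {i}. g k ((x(i := y)) k)) = (\<Sum>k\<in>UNIV - {i}. g k (x k))"
    by (rule sum.cong) auto
  ultimately show ?thesis
    by simp
qed

lemma load_nonneg:
  assumes "resource_model X g" and "x \<in> Pi UNIV X"
  shows "0 \<le> load g x"
  unfolding load_def using assms by (intro sum_nonneg) (auto simp: resource_model_def Pi_iff)

lemma load_deviation_ge:
  assumes "overlapping_structure X g" and "use_monotone X g"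
    and "x \<in> Pi UNIV X" and "y \<in> X i" and "j \<in> used_resources y"
  shows "load g x $ j \<le> load g (x(i := y)) $ j"
proof -
  have "x i \<in> X i"
    using assms(3) by auto
  \<comment> \<open>Only the summand of \<open>i\<close> changes, so its own consumption of
    \<open>j\<close> decides the comparison.\<close>
  have "g i (x i) $ j \<le> g i y $ j"
  proof (cases "j \<in> used_resources (x i)")
    case True
    then have "g i (x i) $ j = g i y $ j"
      using assms(1,4,5) \<open>x i \<in> X i\<close> unfolding overlapping_structure_def by blast
    then show ?thesis
      by simp
  next
    \<comment> \<open>Here \<open>j\<close> is newly used: \<open>use_monotone\<close> applies with
      \<open>y\<close> as the using and \<open>x i\<close> as the idle strategy.\<close>
    case False
    then show ?thesis
      using assms(2,4,5) \<open>x i \<in> X i\<close> unfolding use_monotone_def by blast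
  qed
  then show ?thesis
    by (simp add: load_fun_upd)
qed

text \<open>Monotonicity alone would require \<open>u \<le> w\<close> in every component;
  independence of irrelevant alternatives removes the comparison outside
  \<open>used_resources y\<close>.\<close>

lemma monotone_aggregative_min_le_on_used:
  assumes "monotone_aggregative_min X g \<pi>" and "y \<in> X i" and "0 \<le> u" and "0 \<le> w"
    and le: "\<And>j. j \<in> used_resources y \<Longrightarrow> u $ j \<le> w $ j"
  shows "\<pi> i u y \<le> \<pi> i w y"
proof -
  \<comment> \<open>This hybrid has the same cost as \<open>u\<close>, since both agree on what
    \<open>y\<close> uses, and it lies below \<open>w\<close>, since it equals \<open>w\<close>
    elsewhere.\<close>
  define z :: "real ^ 'b" where "z = (\<chi> j. if j \<in> used_resources y then u $ j else w $ j)"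
  have "0 \<le> z" "z \<le> w"
    using assms(3,4) le by (auto simp: z_def less_eq_vec_def)
  moreover have "\<forall>j\<in>used_resources y. u $ j = z $ j"
    by (simp add: z_def)
  moreover from this have "\<pi> i u y = \<pi> i z y"
    using assms(1-3) \<open>0 \<le> z\<close>
    unfolding monotone_aggregative_min_def irrelevant_independent_def by blast
  moreover have "\<pi> i z y \<le> \<pi> i w y"
    using assms(1,2) \<open>0 \<le> z\<close> \<open>z \<le> w\<close> unfolding monotone_aggregative_min_def by blast
  ultimately show ?thesis
    by simp
qed

text \<open>Fixed-load optimality evaluates costs only at \<open>u\<close>, so agreement of
  \<open>\<pi>\<close> and \<open>\<pi>mag\<close> there suffices. The price terms of both games
  coincide, which leaves only costs to compare.\<close>

lemma enforces_min_mag_if_enforces_min: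
  assumes model: "resource_model X g" "use_monotone X g"
    and mag: "monotone_aggregative_min X g \<pi>mag"
    and eq: "\<And>i y. y \<in> X i \<Longrightarrow> \<pi> i u y = \<pi>mag i u y"
    and xs: "xs \<in> Pi UNIV X" and enf: "enforces_min X g \<pi> u xs p"
  shows "enforces_min_mag X g \<pi>mag u xs p"
proof -
  have u: "load g xs = u"
    using enf by (simp add: enforces_min_def)
  \<comment> \<open>The trivial update \<open>xs(i := xs i)\<close> is how the optimality condition
    expresses not deviating.\<close>
  have "\<pi>mag i (load g (xs(i := xs i))) (xs i) + p \<bullet> g i (xs i)
      \<le> \<pi>mag i (load g (xs(i := y))) y + p \<bullet> g i y" if y: "y \<in> X i" for i y
  proof -
    have "xs i \<in> X i"
      using xs by auto
    then have "\<pi>mag i u (xs i) + p \<bullet> g i (xs i) \<le> \<pi>mag i u y + p \<bullet> g i y"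
      using enf y by (simp add: enforces_min_def is_arg_min_linorder flip: eq)
    moreover have "xs(i := y) \<in> Pi UNIV X"
      using xs y by auto
    then have "0 \<le> load g (xs(i := y))"
      by (rule load_nonneg[OF model(1)])
    then have "\<pi>mag i (load g xs) y \<le> \<pi>mag i (load g (xs(i := y))) y"
      using mag load_nonneg[OF model(1) xs] load_deviation_ge[OF _ model(2) xs y]
      by (intro monotone_aggregative_min_le_on_used[OF mag y])
        (simp_all add: monotone_aggregative_min_def)
    ultimately show ?thesis
      using u by simp
  qed
  then show ?thesis
    using xs u by (auto simp: enforces_min_mag_def is_arg_min_linorder)
qed

lemma monotone_aggregative_max_iff_min:
  "monotone_aggregative_max X g v \<longleftrightarrow> monotone_aggregative_min X g (\<lambda>i w y. - v i w y)"
  by (simp add: monotone_aggregative_max_def monotone_aggregative_min_def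
      irrelevant_independent_def)

lemma enforces_max_iff_min:
  "enforces_max X g v u xs p \<longleftrightarrow> enforces_min X g (\<lambda>i w y. - v i w y) u xs p"
  by (simp add: enforces_max_def enforces_min_def is_arg_max_def is_arg_min_def algebra_simps)

lemma enforces_max_mag_iff_min_mag:
  "enforces_max_mag X g v u xs p \<longleftrightarrow> enforces_min_mag X g (\<lambda>i w y. - v i w y) u xs p"
  by (simp add: enforces_max_mag_def enforces_min_mag_def is_arg_max_def is_arg_min_def
      algebra_simps)

theorem theorem5p3:
  fixes X :: "'n::finite \<Rightarrow> (real ^ 'e::finite) set"
    and g :: "'n \<Rightarrow> real ^ 'e \<Rightarrow> real ^ 'e"
  assumes "resource_model X g"
    and "use_monotone X g"
  shows
    "(\<forall>\<pi>mag \<pi> u xs p.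
        monotone_aggregative_min X g \<pi>mag \<and> 0 \<le> u \<and>
        (\<forall>i. \<forall>y\<in>X i. \<pi> i u y = \<pi>mag i u y) \<and>
        xs \<in> Pi UNIV X \<and> 0 \<le> p \<and> enforces_min X g \<pi> u xs p
        \<longrightarrow> enforces_min_mag X g \<pi>mag u xs p) \<and>
     (\<forall>vmag v u xs p.
        monotone_aggregative_max X g vmag \<and> 0 \<le> u \<and>
        (\<forall>i. \<forall>y\<in>X i. v i u y = vmag i u y) \<and>
        xs \<in> Pi UNIV X \<and> 0 \<le> p \<and> enforces_max X g v u xs p
        \<longrightarrow> enforces_max_mag X g vmag u xs p)"
proof (intro conjI allI impI, goal_cases)
  case (1 \<pi>mag \<pi> u xs p)
  then show ?case
    by (intro enforces_min_mag_if_enforces_min[OF assms, where \<pi> = \<pi>]) simp_all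
next
  case (2 vmag v u xs p)
  \<comment> \<open>The fixed-load costs are the negated \<open>v\<close>, which agree with the
    negated \<open>vmag\<close> at \<open>u\<close>.\<close>
  then show ?case
    unfolding monotone_aggregative_max_iff_min enforces_max_iff_min enforces_max_mag_iff_min_mag
    by (intro enforces_min_mag_if_enforces_min[OF assms, where \<pi> = "\<lambda>i w y. - v i w y"]) simp_all
qed

end
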